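(* Let $n>1$ be an integer, let $V=\{v\in\{-1,1\}^n : v_1=1\}$, and for a real number $M$ let $K_M=\{(x_1,\dots,x_n)\in\mathbb{R}^n : x_i\le M \text{ for all } i\in[n]\}$. Consider the balancing game $G(V,K_M)$. Then: (1) If $n$ is odd, Chooser has a winning strategy if and only if $M\ge 2^{n-2}-\frac12\binom{n-1}{(n-1)/2}$. (2) If $n$ is even and not a power of $2$, Chooser has a winning strategy if and only if $M\ge 2^{n-2}-\frac12\binom{n-1}{n/2}$. (3) If $n$ is a power of $2$, Chooser has a winning strategy if and only if $M\ge 2^{n-2}-\frac12\binom{n-1}{n/2}+\frac12$. In each case the critical value of $M$ is $2^{n-2}(1-O(n^{-1/2}))$.
   Context: For a set $V\subset\mathbb{R}^n$ and a convex set $K\subseteq\mathbb{R}^n$, the balancing game $G(V,K)$ is a perfect-information game between Pusher and Chooser producing a sequence of points $z_0=0,z_1,z_2,\dots\in\mathbb{R}^n$: in round $k$, Pusher offers a vector $v_k\in V$, Chooser selects $\varepsilon_k\in\{-1,1\}$, and the next position is $z_{k+1}=z_k+\varepsilon_k v_k$. Pusher wins if at some point $z_k\notin K$; Chooser wins if she can keep $z_k\in K$ for all $k$. *)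

theory Defs
  imports Complex_Main "HOL-Library.Landau_Symbols"
begin

text \<open>Vectors of R^n are represented as functions nat => real whose coordinates
  0,...,n-1 are the n coordinates (coordinate 0 corresponds to x_1); coordinates
  at index >= n are 0 for all vectors in V and are irrelevant for K.\<close>

text \<open>Positions of the balancing game: Chooser's strategy sigma maps the history
  of Pusher's offered vectors (before round k) and the currently offered vector
  to a sign in {-1,1}; vs is the sequence of offered vectors.\<close>
fun game_pos :: "((nat \<Rightarrow> real) list \<Rightarrow> (nat \<Rightarrow> real) \<Rightarrow> real)
    \<Rightarrow> (nat \<Rightarrow> (nat \<Rightarrow> real)) \<Rightarrow> nat \<Rightarrow> (nat \<Rightarrow> real)" where
  "game_pos \<sigma> vs 0 = (\<lambda>i. 0)"
| "game_pos \<sigma> vs (Suc k) =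
     (\<lambda>i. game_pos \<sigma> vs k i + \<sigma> (map vs [0..<k]) (vs k) * vs k i)"

text \<open>Chooser has a winning strategy in G(V,K): a strategy keeping every position
  in K against every sequence of offers from V (against a fixed deterministic
  Chooser strategy, every Pusher strategy amounts to such a sequence).\<close>
definition chooser_wins :: "(nat \<Rightarrow> real) set \<Rightarrow> (nat \<Rightarrow> real) set \<Rightarrow> bool" where
  "chooser_wins V K \<longleftrightarrow>
     (\<exists>\<sigma>. (\<forall>h v. \<sigma> h v \<in> {-1, 1}) \<and>
          (\<forall>vs. (\<forall>k. vs k \<in> V) \<longrightarrow> (\<forall>k. game_pos \<sigma> vs k \<in> K)))"

definition Vset :: "nat \<Rightarrow> (nat \<Rightarrow> real) set" where
  "Vset n = {v. (\<forall>i<n. v i \<in> {-1, 1}) \<and> (\<forall>i\<ge>n. v i = 0) \<and> v 0 = 1}"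

definition Kset :: "nat \<Rightarrow> real \<Rightarrow> (nat \<Rightarrow> real) set" where
  "Kset n M = {x. \<forall>i<n. x i \<le> M}"

definition crit :: "nat \<Rightarrow> real" where
  "crit n = (if odd n then 2 ^ (n - 2) - (n - 1 choose ((n - 1) div 2)) / 2
             else if (\<exists>k. n = 2 ^ k) then 2 ^ (n - 2) - (n - 1 choose (n div 2)) / 2 + 1 / 2
             else 2 ^ (n - 2) - (n - 1 choose (n div 2)) / 2)"

end

theory Submission
  imports Defs "HOL-Library.Nat_Bijection"
begin

text \<open>
  Identify a vector with its set of \<open>+1\<close> coordinates, so that an offer is a pair of complementary
  subsets of \<open>{..<n}\<close>. The binomial coefficient \<open>C = (n - 1) choose (n div 2)\<close> is odd exactly when
  \<open>n\<close> is a power of 2, so all three critical values equal \<open>2 ^ (n - 2) - C div 2\<close>.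

  Chooser maintains a family \<open>F\<close> containing exactly one set of each complementary pair and answers
  an offer by flipping that pair in \<open>F\<close>. Then the position is half the difference of the sums of
  the sign vectors over the current and the initial family, so its \<open>i\<close>-th coordinate is at most
  \<open>2 ^ (n - 2)\<close> minus half the \<open>i\<close>-th coordinate of the initial sum. The sets of more than half size
  contribute \<open>C\<close> to every coordinate of the initial sum. The half-size sets are chosen so that their
  contributions are congruent modulo 4, sum up to 0 and have the least sum of squares; exchanging
  elements in two sets then shows that no contribution is less than \<open>- (C mod 2)\<close>.

  For the converse, consider the set \<open>W\<close> of positions reachable under a winning strategy and a
  positive weight \<open>w\<close> with distinct subset sums. Raise the \<open>i\<close>-th weight and follow a maximizer of
  the weighted sum over \<open>W\<close>. Whenever the weight becomes orthogonal to the sign vector of a set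
  containing \<open>i\<close>, the maximizers are invariant under a move by plus or minus that vector, so the
  \<open>i\<close>-th coordinate increases by at least 1 there, but it never exceeds \<open>M\<close>. Counting these sets
  bounds the coordinates of a maximizer for \<open>w\<close> itself; comparing with the position 0 and letting
  \<open>w\<close> tend to the all-ones direction gives \<open>2 ^ (n - 1) - C \<le> 2 * \<lfloor>M\<rfloor>\<close>.
\<close>

section \<open>The middle binomial coefficient\<close>

definition middle_binomial :: "nat \<Rightarrow> nat" where
  "middle_binomial n = (n - 1) choose (n div 2)"

lemma central_binomial_double:
  assumes "k > 0"
  shows "2 * k choose k = 2 * ((2 * k - 1) choose k)"
proof -
  obtain l where l: "k = Suc l" using assms by (cases k) auto
  have "2 * l + 1 choose Suc l = 2 * l + 1 choose l"
    using central_binomial_odd[of "2 * l + 1"] by simp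
  then show ?thesis by (simp add: l)
qed

lemma middle_binomial_double: "k > 0 \<Longrightarrow> 2 * k choose k = 2 * middle_binomial (2 * k)"
  by (simp add: middle_binomial_def central_binomial_double)

lemma middle_binomial_Suc_double: "middle_binomial (Suc (2 * k)) = 2 * k choose k"
  by (simp add: middle_binomial_def)

lemma odd_binomial_iff:
  "odd (n choose k) \<longleftrightarrow> odd (n div 2 choose (k div 2)) \<and> (odd k \<longrightarrow> odd n)"
proof (induction n arbitrary: k)
  case 0
  consider "k = 0" | "k = 1" | "k div 2 > 0" by linarith
  then show ?case by cases (simp_all add: binomial_eq_0)
next
  case (Suc n)
  show ?case
  proof (cases k)
    case (Suc l)
    have "odd (Suc n choose k) \<longleftrightarrow> odd (n choose l) \<noteq> odd (n choose Suc l)"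
      by (simp add: Suc)
    then show ?thesis
      unfolding Suc.IH Suc by (cases "even n"; cases "even l") (auto elim!: evenE oddE)
  qed simp
qed

lemma odd_eq_power_of_2_iff:
  assumes "odd (n :: nat)"
  shows "(\<exists>k. n = 2 ^ k) \<longleftrightarrow> n = 1"
proof
  assume "\<exists>k. n = 2 ^ k"
  then obtain k where k: "n = 2 ^ k" ..
  with assms have "k = 0" by simp
  with k show "n = 1" by simp
qed (auto intro: exI[of _ 0])

lemma odd_middle_binomial_iff_power_of_2:
  assumes "n > 0"
  shows "odd (middle_binomial n) \<longleftrightarrow> (\<exists>k. n = 2 ^ k)"
  using assms
proof (induction n rule: less_induct)
  case (less n)
  show ?case
  proof (cases "even n")
    case True
    then obtain m where m: "n = 2 * m" by (rule evenE)
    with less.prems have "m > 0" by simp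
    then have "(2 * m - 1) div 2 = m - 1" "odd (2 * m - 1)" by presburger+
    then have "odd (middle_binomial n) \<longleftrightarrow> odd (middle_binomial m)"
      using odd_binomial_iff[of "2 * m - 1" m] by (simp add: m middle_binomial_def)
    also have "\<dots> \<longleftrightarrow> (\<exists>k. m = 2 ^ k)" using less.IH[of m] \<open>m > 0\<close> m by simp
    also have "\<dots> \<longleftrightarrow> (\<exists>k. n = 2 ^ k)"
    proof
      assume "\<exists>k. n = 2 ^ k"
      then obtain k where "2 * m = 2 ^ k" using m by auto
      then show "\<exists>k. m = 2 ^ k" by (cases k) auto
    qed (metis m power_Suc)
    finally show ?thesis .
  next
    case False
    then obtain m where m: "n = Suc (2 * m)" by (metis oddE Suc_eq_plus1)
    have "odd (2 * m choose m) \<longleftrightarrow> m = 0"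
      using central_binomial_double[of m] by (cases "m = 0") auto
    then show ?thesis
      using odd_eq_power_of_2_iff[OF False] by (simp add: m middle_binomial_Suc_double)
  qed
qed

lemma central_binomial_squared_le: "(2 * k choose k)\<^sup>2 * (2 * k + 1) \<le> 16 ^ k"
proof (induction k)
  case (Suc k)
  let ?c = "2 * k choose k" and ?d = "2 * Suc k choose Suc k"
  have "?d = 2 * (Suc (2 * k) choose Suc k)" using central_binomial_double[of "Suc k"] by simp
  then have recurrence: "?d * Suc k = 2 * ((2 * k + 1) * ?c)"
    using Suc_times_binomial_eq[of "2 * k" k] by simp
  have "(Suc k)\<^sup>2 * (?d\<^sup>2 * (2 * Suc k + 1)) = (?d * Suc k)\<^sup>2 * (2 * k + 3)"
    by (simp add: power2_eq_square algebra_simps)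
  also have "\<dots> = 4 * ((2 * k + 1) * (2 * k + 3)) * (?c\<^sup>2 * (2 * k + 1))"
    unfolding recurrence by (simp add: power2_eq_square algebra_simps)
  also have "\<dots> \<le> 4 * (4 * (Suc k)\<^sup>2) * 16 ^ k"
  proof (rule mult_mono[OF mult_left_mono Suc.IH])
    show "(2 * k + 1) * (2 * k + 3) \<le> 4 * (Suc k)\<^sup>2" by (simp add: power2_eq_square algebra_simps)
  qed simp_all
  also have "\<dots> = (Suc k)\<^sup>2 * 16 ^ Suc k" by simp
  finally show ?case by (simp only: mult_le_cancel1) simp
qed simp

lemma middle_binomial_squared_le:
  assumes "n > 0"
  shows "(middle_binomial n)\<^sup>2 * n \<le> 4 ^ (n - 1)"
proof (cases "even n")
  case True
  then obtain k where n: "n = 2 * k" by (rule evenE)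
  with assms have "k > 0" by simp
  have "4 * ((middle_binomial n)\<^sup>2 * (2 * k + 1)) = (2 * k choose k)\<^sup>2 * (2 * k + 1)"
    unfolding middle_binomial_double[OF \<open>k > 0\<close>] by (simp add: n power_mult_distrib)
  also have "\<dots> \<le> 16 ^ k" by (rule central_binomial_squared_le)
  also have "\<dots> = 4 * 4 ^ (n - 1)"
    using assms power_mult[of "4 :: nat" 2 k] by (simp add: n flip: power_Suc)
  finally have "(middle_binomial n)\<^sup>2 * (2 * k + 1) \<le> 4 ^ (n - 1)" by simp
  then show ?thesis by (simp add: n)
next
  case False
  then obtain k where "n = Suc (2 * k)" by (metis oddE Suc_eq_plus1)
  then show ?thesis
    using central_binomial_squared_le[of k] by (simp add: middle_binomial_Suc_double power_mult)
qed

lemma middle_binomial_le_power_div_sqrt: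
  assumes "n \<ge> 2"
  shows "real (middle_binomial n) / 2 \<le> 2 ^ (n - 2) / sqrt (real n)"
proof -
  have "(real (middle_binomial n) * sqrt (real n))\<^sup>2 = real ((middle_binomial n)\<^sup>2 * n)"
    by (simp add: power_mult_distrib)
  also have "\<dots> \<le> real (4 ^ (n - 1))"
    using middle_binomial_squared_le[of n] assms by (simp only: of_nat_le_iff)
  also have "\<dots> = (2 ^ (n - 1))\<^sup>2" by (simp add: power2_eq_square flip: power_mult_distrib)
  finally have "real (middle_binomial n) * sqrt (real n) \<le> 2 ^ (n - 1)"
    by (rule power2_le_imp_le) simp
  also have "(2 :: real) ^ (n - 1) = 2 * 2 ^ (n - 2)"
    using assms by (simp add: Suc_diff_le flip: power_Suc)
  finally show ?thesis using assms by (simp add: field_simps)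
qed

section \<open>Transversals of complementary pairs\<close>

definition sign_vec :: "'a set \<Rightarrow> 'a \<Rightarrow> int" where
  "sign_vec A i = (if i \<in> A then 1 else - 1)"

definition sign_sum :: "'a set set \<Rightarrow> 'a \<Rightarrow> int" where
  "sign_sum F i = (\<Sum>A\<in>F. sign_vec A i)"

definition complement_closed :: "'a set \<Rightarrow> 'a set set \<Rightarrow> bool" where
  "complement_closed S U \<longleftrightarrow> U \<subseteq> Pow S \<and> (\<forall>A\<in>U. S - A \<in> U)"

definition transversal :: "'a set \<Rightarrow> 'a set set \<Rightarrow> 'a set set \<Rightarrow> bool" where
  "transversal S U F \<longleftrightarrow> F \<subseteq> U \<and> (\<forall>A\<in>U. A \<in> F \<longleftrightarrow> S - A \<notin> F)"

definition flip_pair :: "'a set \<Rightarrow> 'a set \<Rightarrow> 'a set set \<Rightarrow> 'a set set" where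
  "flip_pair S A F = sym_diff F {A, S - A}"

lemma sign_vec_Diff: "i \<in> S \<Longrightarrow> sign_vec (S - A) i = - sign_vec A i"
  by (simp add: sign_vec_def)

lemma sum_signs:
  assumes "finite X"
  shows "(\<Sum>x\<in>X. if P x then 1 else - 1 :: int) = 2 * int (card {x \<in> X. P x}) - int (card X)"
proof -
  have "(\<Sum>x\<in>X. if P x then 1 else - 1 :: int) = (\<Sum>x\<in>X. 2 * of_bool (P x) - 1)"
    by (intro sum.cong) auto
  also have "\<dots> = 2 * int (card {x \<in> X. P x}) - int (card X)"
    using assms by (simp add: sum_subtractf Int_def flip: sum_distrib_left)
  finally show ?thesis .
qed

lemma sum_sign_vec: "finite S \<Longrightarrow> A \<subseteq> S \<Longrightarrow> (\<Sum>i\<in>S. sign_vec A i) = 2 * int (card A) - int (card S)"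
  unfolding sign_vec_def by (subst sum_signs) (auto intro!: arg_cong[where f = card])

lemma sign_sum_eq_card: "finite F \<Longrightarrow> sign_sum F i = 2 * int (card {A \<in> F. i \<in> A}) - int (card F)"
  unfolding sign_sum_def sign_vec_def by (rule sum_signs)

lemma complement_closed_Pow: "complement_closed S (Pow S)"
  by (auto simp: complement_closed_def)

lemma complement_closedD:
  assumes "complement_closed S U" "A \<in> U"
  shows "A \<subseteq> S" "S - A \<in> U" "S - (S - A) = A"
  using assms by (auto simp: complement_closed_def)

lemma complement_closed_finite: "finite S \<Longrightarrow> complement_closed S U \<Longrightarrow> finite U"
  by (auto simp: complement_closed_def intro: finite_subset)

lemma transversal_finite: "finite S \<Longrightarrow> complement_closed S U \<Longrightarrow> transversal S U F \<Longrightarrow> finite F"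
  by (auto simp: transversal_def dest: complement_closed_finite intro: finite_subset)

lemma transversal_containing:
  "complement_closed S U \<Longrightarrow> a \<in> S \<Longrightarrow> transversal S U {A \<in> U. a \<in> A}"
  by (auto simp: transversal_def complement_closed_def)

lemma transversal_Un:
  assumes "complement_closed S U" "complement_closed S V" "U \<inter> V = {}"
    and "transversal S U F" "transversal S V G"
  shows "transversal S (U \<union> V) (F \<union> G)"
  unfolding transversal_def
proof (intro conjI ballI)
  show "F \<union> G \<subseteq> U \<union> V" using assms(4,5) by (auto simp: transversal_def)
next
  fix A assume "A \<in> U \<union> V"
  then consider "A \<in> U" "A \<notin> V" "S - A \<in> U" "S - A \<notin> V"
    | "A \<in> V" "A \<notin> U" "S - A \<in> V" "S - A \<notin> U"
    using assms(3) complement_closedD(2)[OF assms(1)] complement_closedD(2)[OF assms(2)] by blast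
  then show "A \<in> F \<union> G \<longleftrightarrow> S - A \<notin> F \<union> G"
    using assms(4,5) unfolding transversal_def by cases blast+
qed

lemma sum_transversal:
  fixes g :: "'a set \<Rightarrow> 'b :: comm_semiring_1"
  assumes "finite S" and U: "complement_closed S U" and F: "transversal S U F"
    and symmetric: "\<And>A. A \<in> F \<Longrightarrow> g (S - A) = g A"
  shows "sum g U = 2 * sum g F"
proof -
  have FU: "A \<in> U" "A \<subseteq> S" "S - A \<notin> F" if "A \<in> F" for A
    using F that complement_closedD(1)[OF U] by (auto simp: transversal_def)
  have "U = F \<union> (\<lambda>A. S - A) ` F"
  proof
    show "U \<subseteq> F \<union> (\<lambda>A. S - A) ` F"
    proof
      fix A assume A: "A \<in> U"
      then have "A \<in> F \<or> S - A \<in> F" using F by (auto simp: transversal_def)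
      moreover have "A = S - (S - A)" by (rule complement_closedD(3)[OF U A, symmetric])
      ultimately show "A \<in> F \<union> (\<lambda>A. S - A) ` F" by (metis UnI1 UnI2 imageI)
    qed
    show "F \<union> (\<lambda>A. S - A) ` F \<subseteq> U" using FU(1) complement_closedD(2)[OF U] by blast
  qed
  moreover have "F \<inter> (\<lambda>A. S - A) ` F = {}" using FU(3) by blast
  moreover have "finite F" using transversal_finite assms by blast
  ultimately have "sum g U = sum g F + sum g ((\<lambda>A. S - A) ` F)" by (simp add: sum.union_disjoint)
  also have "inj_on (\<lambda>A. S - A) F" by (rule inj_onI) (metis FU(2) double_diff order_refl)
  then have "sum g ((\<lambda>A. S - A) ` F) = sum g F" by (simp add: sum.reindex symmetric)
  finally show ?thesis by (simp add: mult_2)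
qed

lemma card_transversal:
  assumes "finite S" "complement_closed S U" "transversal S U F"
  shows "2 * card F = card U"
  using sum_transversal[OF assms, of "\<lambda>_. 1 :: nat"] by simp

lemma card_transversal_Pow:
  assumes "finite S" "S \<noteq> {}" "transversal S (Pow S) F"
  shows "card F = 2 ^ (card S - 1)"
proof -
  have "card S > 0" using assms by (simp add: card_gt_0_iff)
  then have "2 * card F = 2 * 2 ^ (card S - 1)"
    using card_transversal[OF assms(1) complement_closed_Pow assms(3)] assms(1)
    by (simp add: card_Pow flip: power_Suc)
  then show ?thesis by simp
qed

lemma transversal_flip_pair:
  assumes U: "complement_closed S U" and F: "transversal S U F" and A: "A \<in> U"
  shows "transversal S U (flip_pair S A F)"
  unfolding transversal_def
proof (intro conjI ballI)
  show "flip_pair S A F \<subseteq> U"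
    using F A complement_closedD(2)[OF U A] by (auto simp: transversal_def flip_pair_def)
next
  fix B assume B: "B \<in> U"
  have "S - B \<in> {A, S - A} \<longleftrightarrow> B \<in> {A, S - A}"
    using complement_closedD[OF U A] complement_closedD[OF U B] by auto
  moreover have "B \<in> F \<longleftrightarrow> S - B \<notin> F" using F B by (simp add: transversal_def)
  ultimately show "B \<in> flip_pair S A F \<longleftrightarrow> S - B \<notin> flip_pair S A F"
    unfolding flip_pair_def by blast
qed

lemma sign_sum_flip_pair:
  assumes "finite S" and U: "complement_closed S U" and F: "transversal S U F"
    and A: "A \<in> U" and i: "i \<in> S"
  shows "sign_sum (flip_pair S A F) i = sign_sum F i - 2 * sign_vec F A * sign_vec A i"
proof -
  have "finite F" using transversal_finite assms by blast
  have exchange: "sign_sum (insert (S - B) (F - {B})) i = sign_sum F i - 2 * sign_vec B i"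
    if "B \<in> F" "S - B \<notin> F" for B
    using that \<open>finite F\<close> i by (simp add: sign_sum_def sum_diff1 sign_vec_Diff)
  show ?thesis
  proof (cases "A \<in> F")
    case True
    then have "S - A \<notin> F" using F A by (auto simp: transversal_def)
    then have "flip_pair S A F = insert (S - A) (F - {A})"
      using True by (auto simp: flip_pair_def)
    then show ?thesis using exchange[OF True \<open>S - A \<notin> F\<close>] True by (simp add: sign_vec_def[of F])
  next
    case False
    then have "S - A \<in> F" using F A by (auto simp: transversal_def)
    have double: "S - (S - A) = A" by (rule complement_closedD(3)[OF U A])
    have "flip_pair S A F = insert A (F - {S - A})"
      using False \<open>S - A \<in> F\<close> by (auto simp: flip_pair_def)
    then have "sign_sum (flip_pair S A F) i = sign_sum F i - 2 * sign_vec (S - A) i"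
      using exchange[of "S - A", unfolded double] False \<open>S - A \<in> F\<close> by metis
    then show ?thesis using False i by (simp add: sign_vec_Diff sign_vec_def[of F])
  qed
qed

section \<open>Balancing the sum of a transversal\<close>

definition exchange_closed :: "'a set \<Rightarrow> 'a set set \<Rightarrow> bool" where
  "exchange_closed S U \<longleftrightarrow> (\<forall>A\<in>U. \<forall>i\<in>A. \<forall>j\<in>S - A. insert j (A - {i}) \<in> U)"

lemma transversal_residue_mod_4:
  assumes "finite S" and U: "complement_closed S U" and F: "transversal S U F"
    and "F \<noteq> {}" and a: "a \<in> S" and parity: "even (int (card F) - c)"
  shows "\<exists>F'. transversal S U F' \<and> 4 dvd sign_sum F' a - c"
proof -
  obtain A where "A \<in> F" using \<open>F \<noteq> {}\<close> by blast
  then have A: "A \<in> U" "sign_vec F A = 1" using F by (auto simp: transversal_def sign_vec_def)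
  have flip: "sign_sum (flip_pair S A F) a = sign_sum F a - 2 * sign_vec A a"
    using sign_sum_flip_pair[OF \<open>finite S\<close> U F A(1) a] A(2) by simp
  have "finite F" using transversal_finite assms by blast
  then have "even (sign_sum F a - c)" using parity by (simp add: sign_sum_eq_card)
  then have "4 dvd sign_sum F a - c \<or> 4 dvd sign_sum (flip_pair S A F) a - c"
    unfolding flip sign_vec_def by (cases "a \<in> A") (simp_all, presburger+)
  then show ?thesis using F transversal_flip_pair[OF U F A(1)] by blast
qed

lemma sign_sum_diff:
  assumes "finite F"
  shows "sign_sum F i - sign_sum F j =
    2 * int (card {A \<in> F. i \<in> A \<and> j \<notin> A}) - 2 * int (card {A \<in> F. j \<in> A \<and> i \<notin> A})"
proof -
  have "card {A \<in> F. i \<in> A} = card {A \<in> F. i \<in> A \<and> j \<notin> A} + card {A \<in> F. i \<in> A \<and> j \<in> A}" for i j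
    using assms by (subst card_Un_disjoint[symmetric]) (auto intro!: arg_cong[where f = card])
  from this[of i j] this[of j i] show ?thesis
    using assms by (simp add: sign_sum_eq_card conj_commute)
qed

lemma sign_sum_diff_transversal:
  assumes "finite S" and U: "complement_closed S U" and F: "transversal S U F"
    and ij: "i \<in> S" "j \<in> S"
  shows "sign_sum F i - sign_sum F j =
    4 * int (card {A \<in> F. i \<in> A \<and> j \<notin> A}) - 2 * int (card {A \<in> U. i \<in> A \<and> j \<notin> A})"
proof -
  let ?P = "{A \<in> F. i \<in> A \<and> j \<notin> A}" and ?Q = "{A \<in> F. j \<in> A \<and> i \<notin> A}"
  let ?V = "{A \<in> U. (i \<in> A) \<noteq> (j \<in> A)}"
  have "finite F" using transversal_finite assms by blast
  have V: "complement_closed S ?V" using U ij by (auto simp: complement_closed_def)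
  have "transversal S ?V {A \<in> F. (i \<in> A) \<noteq> (j \<in> A)}"
    using F ij by (auto simp: transversal_def)
  then have "2 * card {A \<in> F. (i \<in> A) \<noteq> (j \<in> A)} = card ?V"
    by (rule card_transversal[OF \<open>finite S\<close> V])
  moreover have "2 * card {A \<in> ?V. i \<in> A} = card ?V"
    by (rule card_transversal[OF \<open>finite S\<close> V transversal_containing[OF V ij(1)]])
  moreover have "{A \<in> ?V. i \<in> A} = {A \<in> U. i \<in> A \<and> j \<notin> A}" by blast
  moreover have "{A \<in> F. (i \<in> A) \<noteq> (j \<in> A)} = ?P \<union> ?Q" by blast
  moreover have "card (?P \<union> ?Q) = card ?P + card ?Q"
    using \<open>finite F\<close> by (intro card_Un_disjoint) auto
  ultimately have "card {A \<in> U. i \<in> A \<and> j \<notin> A} = card ?P + card ?Q" by simp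
  then show ?thesis unfolding sign_sum_diff[OF \<open>finite F\<close>] by simp
qed

lemma sign_sum_less_imp_exchange:
  assumes "finite F" "i \<noteq> j" and less: "sign_sum F j < sign_sum F i"
  obtains A where "A \<in> F" "i \<in> A" "j \<notin> A" "insert j (A - {i}) \<notin> F"
proof -
  let ?P = "{A \<in> F. i \<in> A \<and> j \<notin> A}" and ?Q = "{A \<in> F. j \<in> A \<and> i \<notin> A}"
  let ?exchange = "\<lambda>A. insert j (A - {i})"
  have "inj_on ?exchange ?P"
    by (rule inj_on_inverseI[where g = "\<lambda>B. insert i (B - {j})"]) auto
  then have "card (?exchange ` ?P) = card ?P" by (rule card_image)
  then have "card ?Q < card (?exchange ` ?P)"
    using less sign_sum_diff[OF \<open>finite F\<close>, of i j] by linarith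
  moreover have "finite ?Q" using \<open>finite F\<close> by simp
  ultimately have "\<not> ?exchange ` ?P \<subseteq> ?Q" by (meson card_mono leD)
  then obtain A where "A \<in> ?P" "?exchange A \<notin> ?Q" unfolding image_subset_iff by blast
  then show ?thesis using that[of A] \<open>i \<noteq> j\<close> by simp
qed

lemma transversal_transfer:
  assumes "finite S" "2 < card S" and U: "complement_closed S U" "exchange_closed S U"
    and F: "transversal S U F"
    and ij: "i \<in> S" "j \<in> S" and less: "sign_sum F j < sign_sum F i"
  shows "\<exists>F'. transversal S U F' \<and> (\<forall>l\<in>S. sign_sum F' l =
    sign_sum F l - (if l = i then 4 else 0) + (if l = j then 4 else 0))"
proof -
  have "finite F" using transversal_finite assms by blast
  have "i \<noteq> j" using less by blast
  then obtain A where A: "A \<in> F" "i \<in> A" "j \<notin> A" and notin: "insert j (A - {i}) \<notin> F"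
    using sign_sum_less_imp_exchange[OF \<open>finite F\<close> _ less] by blast
  define B where "B = insert j (A - {i})"
  have AU: "A \<in> U" using A(1) F by (auto simp: transversal_def)
  then have BU: "B \<in> U" using A ij U(2) by (auto simp: exchange_closed_def B_def)
  have AS: "A \<subseteq> S" using complement_closedD(1)[OF U(1) AU] .
  have "B \<noteq> S - A"
  proof
    assume "B = S - A"
    then have "S \<subseteq> {i, j}" using AS by (auto simp: B_def)
    then have "card S \<le> card {i, j}" by (intro card_mono) auto
    then show False using \<open>2 < card S\<close> \<open>i \<noteq> j\<close> by simp
  qed
  then have B: "B \<notin> flip_pair S A F" using notin A by (auto simp: flip_pair_def B_def)
  have flipped: "transversal S U (flip_pair S A F)" by (rule transversal_flip_pair[OF U(1) F AU])
  have "transversal S U (flip_pair S B (flip_pair S A F))"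
    by (rule transversal_flip_pair[OF U(1) flipped BU])
  moreover have "sign_sum (flip_pair S B (flip_pair S A F)) l =
      sign_sum F l - (if l = i then 4 else 0) + (if l = j then 4 else 0)" if "l \<in> S" for l
  proof -
    have "sign_sum (flip_pair S B (flip_pair S A F)) l =
        sign_sum F l - 2 * sign_vec A l + 2 * sign_vec B l"
      using sign_sum_flip_pair[OF \<open>finite S\<close> U(1) flipped BU that] B
        sign_sum_flip_pair[OF \<open>finite S\<close> U(1) F AU that] A(1)
      by (simp add: sign_vec_def[of F] sign_vec_def[of "flip_pair S A F"])
    also have "2 * sign_vec B l =
        2 * sign_vec A l - (if l = i then 4 else 0) + (if l = j then 4 else 0)"
      using A \<open>i \<noteq> j\<close> by (simp add: sign_vec_def B_def)
    finally show ?thesis by simp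
  qed
  ultimately show ?thesis by blast
qed

lemma sum_squares_transfer_less:
  fixes d d' :: "'a \<Rightarrow> 'b :: linordered_idom"
  assumes "finite S" and ij: "i \<in> S" "j \<in> S" and t: "0 < t" "d j + t < d i"
    and transfer: "\<And>l. l \<in> S \<Longrightarrow> d' l = d l - (if l = i then t else 0) + (if l = j then t else 0)"
  shows "(\<Sum>l\<in>S. (d' l)\<^sup>2) < (\<Sum>l\<in>S. (d l)\<^sup>2)"
proof -
  have "i \<noteq> j" using t by auto
  have "(\<Sum>l\<in>S. (d' l)\<^sup>2) = (\<Sum>l\<in>S. (d l)\<^sup>2 + (if l = i then t\<^sup>2 - 2 * t * d i else 0)
      + (if l = j then t\<^sup>2 + 2 * t * d j else 0))"
    using \<open>i \<noteq> j\<close> by (intro sum.cong refl) (auto simp: transfer power2_eq_square algebra_simps)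
  also have "\<dots> = (\<Sum>l\<in>S. (d l)\<^sup>2) + 2 * (t * (d j + t - d i))"
    using \<open>finite S\<close> ij by (simp add: sum.distrib power2_eq_square algebra_simps)
  also have "\<dots> < (\<Sum>l\<in>S. (d l)\<^sup>2)" using t by (simp add: mult_less_0_iff)
  finally show ?thesis .
qed

lemma transversal_near_constant:
  assumes "finite S" "2 < card S" and U: "complement_closed S U" "exchange_closed S U"
    and "transversal S U F"
  shows "\<exists>F'. transversal S U F' \<and> (\<forall>l\<in>S. 4 dvd sign_sum F' l - sign_sum F l) \<and>
    (\<forall>i\<in>S. \<forall>j\<in>S. sign_sum F' i \<le> sign_sum F' j + 4)"
  using assms(5)
proof (induction F rule: measure_induct_rule[where f = "\<lambda>F. nat (\<Sum>l\<in>S. (sign_sum F l)\<^sup>2)"])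
  case (less F)
  show ?case
  proof (cases "\<forall>i\<in>S. \<forall>j\<in>S. sign_sum F i \<le> sign_sum F j + 4")
    case True
    then show ?thesis using less.prems by (intro exI[of _ F]) simp
  next
    case False
    then obtain i j where ij: "i \<in> S" "j \<in> S" "sign_sum F j + 4 < sign_sum F i" by force
    then have "sign_sum F j < sign_sum F i" by simp
    then obtain F' where F': "transversal S U F'" and transfer: "\<And>l. l \<in> S \<Longrightarrow>
        sign_sum F' l = sign_sum F l - (if l = i then 4 else 0) + (if l = j then 4 else 0)"
      using transversal_transfer[OF assms(1-4) less.prems ij(1,2)] by blast
    have "(\<Sum>l\<in>S. (sign_sum F' l)\<^sup>2) < (\<Sum>l\<in>S. (sign_sum F l)\<^sup>2)"
      using sum_squares_transfer_less[OF \<open>finite S\<close> ij(1,2) _ ij(3) transfer] by simp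
    moreover have "0 \<le> (\<Sum>l\<in>S. (sign_sum F' l)\<^sup>2)" by (simp add: sum_nonneg)
    ultimately have "nat (\<Sum>l\<in>S. (sign_sum F' l)\<^sup>2) < nat (\<Sum>l\<in>S. (sign_sum F l)\<^sup>2)" by simp
    then obtain F'' where F'': "transversal S U F''"
      "\<forall>l\<in>S. 4 dvd sign_sum F'' l - sign_sum F' l"
      "\<forall>i\<in>S. \<forall>j\<in>S. sign_sum F'' i \<le> sign_sum F'' j + 4"
      using less.IH F' by blast
    have "4 dvd sign_sum F'' l - sign_sum F l" if "l \<in> S" for l
    proof -
      have "4 dvd sign_sum F' l - sign_sum F l" using transfer[OF that] by simp
      then show ?thesis using F''(2) that dvd_add by fastforce
    qed
    then show ?thesis using F'' by blast
  qed
qed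

lemma sum_zero_near_constant_ge:
  fixes d :: "'a \<Rightarrow> int"
  assumes "finite S" "j \<in> S" and zero: "(\<Sum>i\<in>S. d i) = 0"
    and near: "\<forall>i\<in>S. d i \<le> d j + t" and residue: "t dvd d j - c" and "c \<le> 0" "0 < t"
  shows "c \<le> d j"
proof (rule ccontr)
  assume "\<not> c \<le> d j"
  moreover have "t dvd c - d j" using residue by (simp add: dvd_diff_commute)
  ultimately have "d j + t \<le> c" using zdvd_imp_le[of t "c - d j"] by simp
  then have "d j < 0" "\<forall>i\<in>S. d i \<le> 0" using near \<open>c \<le> 0\<close> \<open>0 < t\<close> by fastforce+
  then have "(\<Sum>i\<in>S. d i) < (\<Sum>i\<in>S. 0)"
    using assms(1,2) by (intro sum_strict_mono_ex1) auto
  then show False using zero by simp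
qed

section \<open>Half-size and majority sets\<close>

definition halves :: "'a set \<Rightarrow> 'a set set" where
  "halves S = {A. A \<subseteq> S \<and> 2 * card A = card S}"

definition majority :: "'a set \<Rightarrow> 'a set set" where
  "majority S = {A. A \<subseteq> S \<and> card S < 2 * card A}"

lemma card_Diff_subset_add: "finite S \<Longrightarrow> A \<subseteq> S \<Longrightarrow> card (S - A) + card A = card S"
  by (simp add: card_Diff_subset card_mono finite_subset)

lemma double_card_Diff:
  assumes "finite S" "A \<subseteq> S"
  shows "2 * card (S - A) = card S \<longleftrightarrow> 2 * card A = card S"
    and "card S < 2 * card (S - A) \<longleftrightarrow> 2 * card A < card S"
  using card_Diff_subset_add[OF assms] by linarith+

lemma complement_closed_halves: "finite S \<Longrightarrow> complement_closed S (halves S)"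
  by (auto simp: complement_closed_def halves_def double_card_Diff)

lemma complement_closed_nonhalves: "finite S \<Longrightarrow> complement_closed S (Pow S - halves S)"
  by (auto simp: complement_closed_def halves_def double_card_Diff)

lemma exchange_closed_halves:
  assumes "finite S"
  shows "exchange_closed S (halves S)"
  unfolding exchange_closed_def
proof (intro ballI)
  fix A i j assume A: "A \<in> halves S" "i \<in> A" "j \<in> S - A"
  then have "finite A" using assms finite_subset by (auto simp: halves_def)
  then have "card (insert j (A - {i})) = card A"
    using A card_Suc_Diff1[of A i] by (simp del: card_Diff_insert)
  then show "insert j (A - {i}) \<in> halves S" using A by (auto simp: halves_def)
qed

lemma transversal_majority:
  assumes "finite S"
  shows "transversal S (Pow S - halves S) (majority S)"
  unfolding transversal_def
proof (intro conjI ballI)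
  fix A assume "A \<in> Pow S - halves S"
  then have "A \<subseteq> S" "2 * card A \<noteq> card S" by (auto simp: halves_def)
  then show "A \<in> majority S \<longleftrightarrow> S - A \<notin> majority S"
    using double_card_Diff(2)[OF assms, of A] by (auto simp: majority_def)
qed (auto simp: majority_def halves_def)

lemma sign_sum_subsets_card_gt:
  assumes "finite S" and i: "i \<in> S"
  shows "sign_sum {A. A \<subseteq> S \<and> r < card A} i = int ((card S - 1) choose r)"
proof -
  let ?P = "Pow (S - {i})"
  let ?g = "\<lambda>A. if r < card A then sign_vec A i else 0"
  have split: "Pow S = ?P \<union> insert i ` ?P"
    using Pow_insert[of i "S - {i}"] i by (simp add: insert_absorb)
  have "sign_sum {A. A \<subseteq> S \<and> r < card A} i = (\<Sum>A\<in>Pow S. ?g A)"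
    unfolding sign_sum_def using \<open>finite S\<close>
    by (subst sum.inter_filter[symmetric]) (auto intro!: sum.cong)
  also have "\<dots> = (\<Sum>A\<in>?P. ?g A) + (\<Sum>A\<in>insert i ` ?P. ?g A)"
    unfolding split using \<open>finite S\<close> by (intro sum.union_disjoint) auto
  also have "(\<Sum>A\<in>insert i ` ?P. ?g A) = (\<Sum>A\<in>?P. ?g (insert i A))"
    by (subst sum.reindex) (auto simp: inj_on_def)
  also have "(\<Sum>A\<in>?P. ?g A) + (\<Sum>A\<in>?P. ?g (insert i A)) = (\<Sum>A\<in>?P. of_bool (card A = r))"
    unfolding sum.distrib[symmetric]
  proof (intro sum.cong refl)
    fix A assume A: "A \<in> ?P"
    then have "finite A" using \<open>finite S\<close> finite_subset by auto
    then have "card (insert i A) = Suc (card A)" using A by (subst card_insert_disjoint) auto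
    then show "?g A + ?g (insert i A) = of_bool (card A = r)" using A by (auto simp: sign_vec_def)
  qed
  also have "\<dots> = int (card {A. A \<subseteq> S - {i} \<and> card A = r})"
    using \<open>finite S\<close> by (simp add: Int_def)
  finally show ?thesis using n_subsets[of "S - {i}" r] assms by simp
qed

lemma sign_sum_majority:
  "finite S \<Longrightarrow> i \<in> S \<Longrightarrow> sign_sum (majority S) i = int (middle_binomial (card S))"
  using sign_sum_subsets_card_gt[of S i "card S div 2"]
  by (simp add: majority_def middle_binomial_def div_less_iff_less_mult mult.commute)

lemma card_subsets_separating:
  assumes "finite S" and ij: "i \<in> S" "j \<in> S" "i \<noteq> j"
  shows "card {A. A \<subseteq> S \<and> card A = Suc k \<and> i \<in> A \<and> j \<notin> A} = (card S - 2) choose k"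
proof -
  let ?R = "{X. X \<subseteq> S - {i, j} \<and> card X = k}"
  have "{A. A \<subseteq> S \<and> card A = Suc k \<and> i \<in> A \<and> j \<notin> A} = insert i ` ?R"
  proof (intro equalityI subsetI)
    fix A assume A: "A \<in> {A. A \<subseteq> S \<and> card A = Suc k \<and> i \<in> A \<and> j \<notin> A}"
    then have "A = insert i (A - {i})" "A - {i} \<in> ?R" by auto
    then show "A \<in> insert i ` ?R" by blast
  next
    fix A assume "A \<in> insert i ` ?R"
    then obtain X where X: "X \<subseteq> S - {i, j}" "card X = k" "A = insert i X" by blast
    then have "finite X" "i \<notin> X" using \<open>finite S\<close> finite_subset by blast+
    then have "card A = Suc k" using X by simp
    then show "A \<in> {A. A \<subseteq> S \<and> card A = Suc k \<and> i \<in> A \<and> j \<notin> A}" using X ij by auto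
  qed
  moreover have "inj_on (insert i) ?R" by (intro inj_onI) (auto simp: insert_eq_iff)
  ultimately have "card {A. A \<subseteq> S \<and> card A = Suc k \<and> i \<in> A \<and> j \<notin> A} = card ?R"
    by (simp add: card_image)
  also have "\<dots> = card (S - {i, j}) choose k" using \<open>finite S\<close> by (intro n_subsets) simp
  also have "card (S - {i, j}) = card S - 2" using ij by (simp add: card_Diff_subset)
  finally show ?thesis .
qed

lemma card_transversal_halves:
  assumes "finite S" "S \<noteq> {}" "even (card S)" and "transversal S (halves S) F"
  shows "card F = middle_binomial (card S)"
proof -
  obtain m where m: "card S = 2 * m" using \<open>even (card S)\<close> by (rule evenE)
  moreover have "card S > 0" using assms by (simp add: card_gt_0_iff)
  ultimately have "m > 0" by simp
  have "halves S = {A. A \<subseteq> S \<and> card A = m}" by (simp add: halves_def m)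
  then have "card (halves S) = card S choose m" using \<open>finite S\<close> by (simp add: n_subsets)
  then have "card (halves S) = 2 * middle_binomial (card S)"
    using middle_binomial_double[OF \<open>m > 0\<close>] by (simp add: m)
  then show ?thesis
    using card_transversal[OF \<open>finite S\<close> complement_closed_halves assms(4)] assms(1) by simp
qed

lemma sum_sign_sum_halves:
  assumes "finite S" "F \<subseteq> halves S"
  shows "(\<Sum>i\<in>S. sign_sum F i) = 0"
proof -
  have "(\<Sum>i\<in>S. sign_sum F i) = (\<Sum>A\<in>F. \<Sum>i\<in>S. sign_vec A i)"
    unfolding sign_sum_def by (rule sum.swap)
  also have "\<dots> = 0"
    using assms by (intro sum.neutral) (auto simp: halves_def sum_sign_vec)
  finally show ?thesis .
qed

lemma transversal_halves_cong_mod_4: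
  assumes "finite S" "2 < card S" "even (card S)" and F: "transversal S (halves S) F"
    and ij: "i \<in> S" "j \<in> S"
  shows "4 dvd sign_sum F i - sign_sum F j"
proof (cases "i = j")
  case False
  obtain m where m: "card S = 2 * m" using \<open>even (card S)\<close> by (rule evenE)
  define k where "k = m - 1"
  have k: "m = Suc k" "k > 0" using m \<open>2 < card S\<close> by (simp_all add: k_def)
  have "{A \<in> halves S. i \<in> A \<and> j \<notin> A} = {A. A \<subseteq> S \<and> card A = Suc k \<and> i \<in> A \<and> j \<notin> A}"
    using m k by (auto simp: halves_def)
  then have "card {A \<in> halves S. i \<in> A \<and> j \<notin> A} = 2 * k choose k"
    using card_subsets_separating[OF \<open>finite S\<close> ij False, of k] m k by simp
  then have "even (card {A \<in> halves S. i \<in> A \<and> j \<notin> A})"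
    using central_binomial_double[OF k(2)] by simp
  then show ?thesis
    unfolding sign_sum_diff_transversal[OF \<open>finite S\<close> complement_closed_halves[OF \<open>finite S\<close>] F ij]
    by presburger
qed simp

lemma balanced_transversal_halves_gt_2:
  assumes "finite S" "2 < card S" "even (card S)"
  shows "\<exists>F. transversal S (halves S) F \<and>
    (\<forall>i\<in>S. - int (middle_binomial (card S) mod 2) \<le> sign_sum F i)"
proof -
  define c where "c = - int (middle_binomial (card S) mod 2)"
  note closed = complement_closed_halves[OF \<open>finite S\<close>] exchange_closed_halves[OF \<open>finite S\<close>]
  obtain a where a: "a \<in> S" using assms(2) by fastforce
  define E where "E = {A \<in> halves S. a \<in> A}"
  have E: "transversal S (halves S) E"
    unfolding E_def by (rule transversal_containing[OF closed(1) a])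
  have cardE: "card E = middle_binomial (card S)"
    using card_transversal_halves[OF \<open>finite S\<close> _ \<open>even (card S)\<close> E] a by blast
  then have "E \<noteq> {}" using assms(2) by (auto simp: middle_binomial_def)
  moreover have "even (int (card E) - c)" unfolding cardE c_def by presburger
  ultimately obtain F where F: "transversal S (halves S) F" "4 dvd sign_sum F a - c"
    using transversal_residue_mod_4[OF \<open>finite S\<close> closed(1) E _ a] by blast
  then obtain G where G: "transversal S (halves S) G"
    and cong: "\<And>l. l \<in> S \<Longrightarrow> 4 dvd sign_sum G l - sign_sum F l"
    and near: "\<And>i j. i \<in> S \<Longrightarrow> j \<in> S \<Longrightarrow> sign_sum G i \<le> sign_sum G j + 4"
    using transversal_near_constant[OF assms(1,2) closed F(1)] by blast
  have residue: "4 dvd sign_sum G j - c" if "j \<in> S" for j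
    using transversal_halves_cong_mod_4[OF assms G that a] cong[OF a] F(2) by presburger
  have "(\<Sum>i\<in>S. sign_sum G i) = 0"
    using G by (intro sum_sign_sum_halves[OF \<open>finite S\<close>]) (simp add: transversal_def)
  then have "c \<le> sign_sum G j" if "j \<in> S" for j
    using sum_zero_near_constant_ge[of S j "sign_sum G" 4 c] \<open>finite S\<close> near residue that
    by (simp add: c_def)
  then show ?thesis using G by (auto simp: c_def)
qed

lemma balanced_transversal_halves:
  assumes "finite S" "S \<noteq> {}"
  shows "\<exists>F. transversal S (halves S) F \<and>
    (\<forall>i\<in>S. - int (middle_binomial (card S) mod 2) \<le> sign_sum F i)"
proof -
  have "card S > 0" using assms by (simp add: card_gt_0_iff)
  then consider (odd) "odd (card S)" | (pair) "card S = 2" | (large) "2 < card S" "even (card S)"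
    by fastforce
  then show ?thesis
  proof cases
    case odd
    then have "2 * card A \<noteq> card S" for A :: "'a set" by presburger
    then have "halves S = {}" by (simp add: halves_def)
    then show ?thesis by (intro exI[of _ "{}"]) (simp add: transversal_def sign_sum_def)
  next
    case pair
    obtain a where "a \<in> S" using assms by blast
    define F where "F = {A \<in> halves S. a \<in> A}"
    have F: "transversal S (halves S) F"
      unfolding F_def using complement_closed_halves[OF \<open>finite S\<close>] \<open>a \<in> S\<close>
      by (rule transversal_containing)
    have "middle_binomial (card S) = 1" by (simp add: pair middle_binomial_def)
    moreover from this have "card F = 1" using card_transversal_halves[OF assms _ F] pair by simp
    then obtain A where "F = {A}" by (rule card_1_singletonE)
    then have "- 1 \<le> sign_sum F i" for i by (simp add: sign_sum_def sign_vec_def)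
    ultimately show ?thesis using F by (intro exI[of _ F]) simp
  next
    case large
    then show ?thesis using balanced_transversal_halves_gt_2 assms(1) by blast
  qed
qed

lemma balanced_transversal_Pow:
  assumes "finite S" "S \<noteq> {}"
  shows "\<exists>F. transversal S (Pow S) F \<and>
    (\<forall>i\<in>S. 2 * int (middle_binomial (card S) div 2) \<le> sign_sum F i)"
proof -
  obtain H where H: "transversal S (halves S) H"
    and bound: "\<And>i. i \<in> S \<Longrightarrow> - int (middle_binomial (card S) mod 2) \<le> sign_sum H i"
    using balanced_transversal_halves[OF assms] by blast
  have disjoint: "(Pow S - halves S) \<inter> halves S = {}" by blast
  have "(Pow S - halves S) \<union> halves S = Pow S" by (auto simp: halves_def)
  then have T: "transversal S (Pow S) (majority S \<union> H)"
    using transversal_Un[OF complement_closed_nonhalves complement_closed_halves disjoint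
        transversal_majority H] \<open>finite S\<close> by simp
  have "2 * int (middle_binomial (card S) div 2) \<le> sign_sum (majority S \<union> H) i" if "i \<in> S" for i
  proof -
    have "finite (majority S \<union> H)"
      using transversal_finite[OF _ complement_closed_Pow T] assms by blast
    moreover have "majority S \<inter> halves S = {}" by (auto simp: majority_def halves_def)
    then have "majority S \<inter> H = {}" using H unfolding transversal_def by blast
    ultimately have "sign_sum (majority S \<union> H) i = sign_sum (majority S) i + sign_sum H i"
      by (simp add: sign_sum_def sum.union_disjoint)
    then show ?thesis
      using bound[OF that] sign_sum_majority[OF \<open>finite S\<close> that] by presburger
  qed
  then show ?thesis using T by blast
qed

section \<open>Chooser's strategy\<close>

definition positives :: "(nat \<Rightarrow> real) \<Rightarrow> nat set" where
  "positives v = {i. v i = 1}"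

definition chooser_family :: "nat \<Rightarrow> nat set set \<Rightarrow> (nat \<Rightarrow> real) list \<Rightarrow> nat set set" where
  "chooser_family n F h = fold (\<lambda>v. flip_pair {..<n} (positives v)) h F"

definition chooser_sign :: "nat \<Rightarrow> nat set set \<Rightarrow> (nat \<Rightarrow> real) list \<Rightarrow> (nat \<Rightarrow> real) \<Rightarrow> real" where
  "chooser_sign n F h v = - real_of_int (sign_vec (chooser_family n F h) (positives v))"

lemma positives_subset: "v \<in> Vset n \<Longrightarrow> positives v \<subseteq> {..<n}"
  by (force simp: Vset_def positives_def not_less[symmetric])

lemma Vset_eq_sign_vec: "v \<in> Vset n \<Longrightarrow> i < n \<Longrightarrow> v i = real_of_int (sign_vec (positives v) i)"
  by (auto simp: Vset_def positives_def sign_vec_def)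

lemma transversal_chooser_family:
  assumes "transversal {..<n} (Pow {..<n}) F" "set h \<subseteq> Vset n"
  shows "transversal {..<n} (Pow {..<n}) (chooser_family n F h)"
  using assms
proof (induction h arbitrary: F)
  case (Cons v h)
  then have "transversal {..<n} (Pow {..<n}) (flip_pair {..<n} (positives v) F)"
    using positives_subset by (intro transversal_flip_pair complement_closed_Pow) auto
  then show ?case using Cons by (simp add: chooser_family_def)
qed (simp add: chooser_family_def)

lemma game_pos_chooser_sign:
  assumes F: "transversal {..<n} (Pow {..<n}) F" and vs: "\<forall>k. vs k \<in> Vset n" and i: "i < n"
  shows "2 * game_pos (chooser_sign n F) vs k i =
    real_of_int (sign_sum (chooser_family n F (map vs [0..<k])) i - sign_sum F i)"
proof (induction k)
  case (Suc k)
  let ?G = "chooser_family n F (map vs [0..<k])" and ?A = "positives (vs k)"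
  have G: "transversal {..<n} (Pow {..<n}) ?G"
    using vs by (intro transversal_chooser_family[OF F]) auto
  have flip: "sign_sum (flip_pair {..<n} ?A ?G) i =
      sign_sum ?G i - 2 * sign_vec ?G ?A * sign_vec ?A i"
    using positives_subset[of "vs k" n] vs i
    by (intro sign_sum_flip_pair[OF _ complement_closed_Pow G]) auto
  have "2 * game_pos (chooser_sign n F) vs (Suc k) i =
      2 * game_pos (chooser_sign n F) vs k i - 2 * real_of_int (sign_vec ?G ?A * sign_vec ?A i)"
    using Vset_eq_sign_vec[of "vs k" n i] vs i by (simp add: chooser_sign_def)
  also have "\<dots> = real_of_int (sign_sum (flip_pair {..<n} ?A ?G) i - sign_sum F i)"
    unfolding Suc.IH flip by simp
  finally show ?case by (simp add: chooser_family_def)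
qed (simp add: chooser_family_def)

lemma sign_sum_le_card: "sign_sum F i \<le> int (card F)"
  using sum_bounded_above[of F "\<lambda>A. sign_vec A i" 1] by (simp add: sign_sum_def sign_vec_def)

lemma chooser_wins_of_transversal:
  assumes "n > 0" and F: "transversal {..<n} (Pow {..<n}) F"
    and M: "\<And>i. i < n \<Longrightarrow> 2 ^ (n - 1) - real_of_int (sign_sum F i) \<le> 2 * M"
  shows "chooser_wins (Vset n) (Kset n M)"
proof -
  have "game_pos (chooser_sign n F) vs k \<in> Kset n M" if vs: "\<forall>k. vs k \<in> Vset n" for vs k
  proof -
    let ?G = "chooser_family n F (map vs [0..<k])"
    have "transversal {..<n} (Pow {..<n}) ?G"
      using vs by (intro transversal_chooser_family[OF F]) auto
    then have "card ?G = 2 ^ (n - 1)" using card_transversal_Pow[of "{..<n}"] \<open>n > 0\<close> by auto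
    then have "real_of_int (sign_sum ?G i) \<le> 2 ^ (n - 1)" for i
      using sign_sum_le_card[of ?G i]
      by (metis of_int_le_iff of_int_of_nat_eq of_nat_numeral of_nat_power)
    then have "2 * game_pos (chooser_sign n F) vs k i \<le> 2 * M" if "i < n" for i
      unfolding game_pos_chooser_sign[OF F vs that] of_int_diff using M[OF that]
      by (rule order_trans[OF diff_right_mono])
    then show ?thesis by (simp add: Kset_def)
  qed
  moreover have "chooser_sign n F h v \<in> {- 1, 1}" for h v
    by (simp add: chooser_sign_def sign_vec_def)
  ultimately show ?thesis unfolding chooser_wins_def by blast
qed

section \<open>Sets closed under moves by sign vectors\<close>

definition sign_move_closed :: "'a set \<Rightarrow> ('a \<Rightarrow> int) set \<Rightarrow> bool" where
  "sign_move_closed S W \<longleftrightarrow>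
    (\<forall>z\<in>W. \<forall>A\<subseteq>S. \<exists>z'\<in>W. \<exists>e\<in>{- 1, 1}. \<forall>j\<in>S. z' j = z j + e * sign_vec A j)"

definition weighted_sum :: "'a set \<Rightarrow> ('a \<Rightarrow> int) \<Rightarrow> ('a \<Rightarrow> int) \<Rightarrow> int" where
  "weighted_sum S w z = (\<Sum>j\<in>S. w j * z j)"

definition maximizer :: "'a set \<Rightarrow> ('a \<Rightarrow> int) set \<Rightarrow> ('a \<Rightarrow> int) \<Rightarrow> ('a \<Rightarrow> int) \<Rightarrow> bool" where
  "maximizer S W w z \<longleftrightarrow> z \<in> W \<and> (\<forall>y\<in>W. weighted_sum S w y \<le> weighted_sum S w z)"

definition light_sets :: "'a set \<Rightarrow> ('a \<Rightarrow> int) \<Rightarrow> 'a set set" where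
  "light_sets S w = {A. A \<subseteq> S \<and> sum w A < sum w (S - A)}"

lemma sum_raise_weight:
  fixes w :: "'a \<Rightarrow> 'b :: ab_group_add"
  assumes "finite A"
  shows "sum (w(i := w i + s)) A = sum w A + (if i \<in> A then s else 0)"
proof -
  have "sum (w(i := w i + s)) A = (\<Sum>j\<in>A. w j + (if j = i then s else 0))"
    by (intro sum.cong) auto
  then show ?thesis using assms by (simp add: sum.distrib)
qed

lemma weighted_sum_raise_weight:
  assumes "finite S" "i \<in> S"
  shows "weighted_sum S (w(i := w i + s)) z = weighted_sum S w z + s * z i"
proof -
  have "weighted_sum S (w(i := w i + s)) z = (\<Sum>j\<in>S. w j * z j + (if j = i then s * z i else 0))"
    unfolding weighted_sum_def by (intro sum.cong) (auto simp: algebra_simps)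
  then show ?thesis using assms by (simp add: sum.distrib weighted_sum_def)
qed

lemma weighted_sum_sign_vec:
  assumes "finite S" "A \<subseteq> S"
  shows "weighted_sum S w (sign_vec A) = sum w A - sum w (S - A)"
proof -
  have "weighted_sum S w (sign_vec A) = (\<Sum>j\<in>S - A. - w j) + (\<Sum>j\<in>A. w j)"
    unfolding weighted_sum_def sum.subset_diff[OF assms(2,1)]
    by (intro arg_cong2[where f = plus] sum.cong) (auto simp: sign_vec_def)
  then show ?thesis by (simp add: sum_negf)
qed

lemma maximizer_exists:
  assumes "W \<noteq> {}" and bound: "\<forall>z\<in>W. \<forall>j\<in>S. z j \<le> m"
    and w: "\<forall>j\<in>S. 0 \<le> w j"
  shows "\<exists>z. maximizer S W w z"
proof -
  have le: "weighted_sum S w z \<le> (\<Sum>j\<in>S. w j * m)" if "z \<in> W" for z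
    unfolding weighted_sum_def using bound that w by (intro sum_mono mult_left_mono) auto
  define gap where "gap z = nat ((\<Sum>j\<in>S. w j * m) - weighted_sum S w z)" for z
  obtain z where z: "z \<in> W" "\<And>y. y \<in> W \<Longrightarrow> gap z \<le> gap y"
    using ex_has_least_nat[of "\<lambda>z. z \<in> W" _ gap] \<open>W \<noteq> {}\<close> by blast
  have "weighted_sum S w y \<le> weighted_sum S w z" if "y \<in> W" for y
    using z(2)[OF that] le[OF that] le[OF z(1)] by (simp add: gap_def)
  then show ?thesis using z(1) by (auto simp: maximizer_def)
qed

lemma maximizer_coordinate_mono:
  assumes "finite S" "i \<in> S" "0 < s"
    and z: "maximizer S W w z" and x: "maximizer S W (w(i := w i + s)) x"
  shows "z i \<le> x i"
proof -
  have "weighted_sum S w x \<le> weighted_sum S w z"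
    "weighted_sum S w z + s * z i \<le> weighted_sum S w x + s * x i"
    using z x weighted_sum_raise_weight[OF assms(1,2)] by (auto simp: maximizer_def)
  then have "s * z i \<le> s * x i" by linarith
  then show ?thesis using \<open>0 < s\<close> by simp
qed

lemma maximizer_orthogonal_move:
  assumes "finite S" "sign_move_closed S W" and y: "maximizer S W w y"
    and A: "A \<subseteq> S" "sum w A = sum w (S - A)" and i: "i \<in> S"
  obtains y' where "maximizer S W w y'" "\<bar>y' i - y i\<bar> = 1"
proof -
  have "y \<in> W" using y by (simp add: maximizer_def)
  then obtain y' e where y': "y' \<in> W" "e \<in> {- 1, 1}" "\<And>j. j \<in> S \<Longrightarrow> y' j = y j + e * sign_vec A j"
    using assms(2) A(1) unfolding sign_move_closed_def by meson
  have "weighted_sum S w y' = weighted_sum S w y + e * weighted_sum S w (sign_vec A)"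
    unfolding weighted_sum_def using y'(3)
    by (simp add: distrib_left sum.distrib sum_distrib_left mult.left_commute)
  then have "maximizer S W w y'"
    using y y'(1) A weighted_sum_sign_vec[OF \<open>finite S\<close> A(1), of w] by (simp add: maximizer_def)
  moreover have "\<bar>y' i - y i\<bar> = 1" using y'(2,3) i by (auto simp: sign_vec_def)
  ultimately show ?thesis by (rule that)
qed

lemma light_sets_eq:
  assumes "finite S"
  shows "light_sets S w = {A. A \<subseteq> S \<and> 2 * sum w A < sum w S}"
  using sum_diff[OF assms, of _ w] by (force simp: light_sets_def)

lemma light_sets_raise_weight:
  fixes w :: "'a \<Rightarrow> int"
  assumes "finite S" "A \<subseteq> S" "i \<in> A"
  defines "w' \<equiv> w(i := w i + (sum w S - 2 * sum w A))"
  shows "sum w' A = sum w' (S - A)"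
    and "{B \<in> light_sets S w'. i \<in> B} = {B. B \<subseteq> S \<and> i \<in> B \<and> sum w B < sum w A}"
proof -
  have raised: "sum w' B = sum w B + (if i \<in> B then sum w S - 2 * sum w A else 0)"
    if "B \<subseteq> S" for B
    unfolding w'_def using finite_subset[OF that \<open>finite S\<close>] by (rule sum_raise_weight)
  have total: "sum w' S = 2 * sum w S - 2 * sum w A"
    using raised[of S] assms(2,3) by auto
  show "sum w' A = sum w' (S - A)"
    using raised[OF assms(2)] total assms(1-3) by (simp add: sum_diff)
  show "{B \<in> light_sets S w'. i \<in> B} = {B. B \<subseteq> S \<and> i \<in> B \<and> sum w B < sum w A}"
    unfolding light_sets_eq[OF \<open>finite S\<close>] total using raised by auto
qed

lemma light_sets_remove_heaviest:
  assumes "finite S" and inj: "inj_on (sum w) {A. A \<subseteq> S \<and> i \<in> A}"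
    and nonempty: "{A \<in> light_sets S w. i \<in> A} \<noteq> {}"
  obtains s A where "0 < s" "A \<in> light_sets S w" "i \<in> A"
    "sum (w(i := w i + s)) A = sum (w(i := w i + s)) (S - A)"
    "{B \<in> light_sets S (w(i := w i + s)). i \<in> B} = {B \<in> light_sets S w. i \<in> B} - {A}"
proof -
  have "finite {A \<in> light_sets S w. i \<in> A}" using \<open>finite S\<close> by (simp add: light_sets_def)
  then obtain A where A: "A \<in> light_sets S w" "i \<in> A"
    and heaviest: "\<And>B. B \<in> light_sets S w \<Longrightarrow> i \<in> B \<Longrightarrow> sum w B \<le> sum w A"
    using arg_min_if_finite[OF _ nonempty, of "\<lambda>A. - sum w A"]
    by (metis (mono_tags, lifting) mem_Collect_eq neg_less_iff_less not_le)
  have AS: "A \<subseteq> S" "2 * sum w A < sum w S" using A(1) by (auto simp: light_sets_eq[OF \<open>finite S\<close>])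
  have "{B. B \<subseteq> S \<and> i \<in> B \<and> sum w B < sum w A} = {B \<in> light_sets S w. i \<in> B} - {A}"
  proof (intro equalityI subsetI)
    fix B assume B: "B \<in> {B \<in> light_sets S w. i \<in> B} - {A}"
    then have BS: "B \<subseteq> S" by (simp add: light_sets_def)
    then have "sum w B \<noteq> sum w A" using inj B A(2) AS(1) by (auto dest: inj_onD)
    then show "B \<in> {B. B \<subseteq> S \<and> i \<in> B \<and> sum w B < sum w A}"
      using B BS heaviest[of B] by simp
  qed (use AS in \<open>auto simp: light_sets_eq[OF \<open>finite S\<close>]\<close>)
  then show ?thesis
    using that[of "sum w S - 2 * sum w A" A] A AS(2)
      light_sets_raise_weight[OF \<open>finite S\<close> AS(1) A(2)] by simp
qed

lemma maximizer_coordinate_le: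
  fixes W :: "('a \<Rightarrow> int) set"
  assumes "finite S" and bound: "\<forall>z\<in>W. \<forall>j\<in>S. z j \<le> m"
    and closed: "sign_move_closed S W" and i: "i \<in> S"
    and w: "\<forall>j\<in>S. 0 \<le> w j" and inj: "inj_on (sum w) {A. A \<subseteq> S \<and> i \<in> A}"
    and z: "maximizer S W w z"
  shows "z i + int (card {A \<in> light_sets S w. i \<in> A}) \<le> m"
  using w inj z
proof (induction "card {A \<in> light_sets S w. i \<in> A}" arbitrary: w z)
  case 0
  then show ?case using bound i by (simp add: maximizer_def)
next
  case (Suc k)
  then have "{A \<in> light_sets S w. i \<in> A} \<noteq> {}" by force
  then obtain s A where "0 < s" and A: "A \<in> light_sets S w" "i \<in> A"
    and eq: "sum (w(i := w i + s)) A = sum (w(i := w i + s)) (S - A)"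
    and light: "{B \<in> light_sets S (w(i := w i + s)). i \<in> B} = {B \<in> light_sets S w. i \<in> B} - {A}"
    using light_sets_remove_heaviest[OF \<open>finite S\<close> Suc.prems(2)] by blast
  let ?w = "w(i := w i + s)"
  have "card {B \<in> light_sets S ?w. i \<in> B} = card {B \<in> light_sets S w. i \<in> B} - 1"
    unfolding light using A by (intro card_Diff_singleton) simp
  then have card: "k = card {B \<in> light_sets S ?w. i \<in> B}" using Suc.hyps(2) by linarith
  have w: "\<forall>j\<in>S. 0 \<le> ?w j" using Suc.prems(1) i \<open>0 < s\<close> by simp
  have "sum ?w B = sum w B + s" if "B \<in> {A. A \<subseteq> S \<and> i \<in> A}" for B
    using that finite_subset[OF _ \<open>finite S\<close>] by (simp add: sum_raise_weight del: fun_upd_apply)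
  then have "inj_on (sum ?w) {A. A \<subseteq> S \<and> i \<in> A}"
    using Suc.prems(2) by (simp add: inj_on_def del: fun_upd_apply)
  note step = Suc.hyps(1)[OF card w this, folded card]
  have "W \<noteq> {}" using Suc.prems(3) by (auto simp: maximizer_def)
  then obtain y where y: "maximizer S W ?w y" using maximizer_exists[OF _ bound w] by blast
  moreover obtain y' where y': "maximizer S W ?w y'" "\<bar>y' i - y i\<bar> = 1"
    using maximizer_orthogonal_move[OF \<open>finite S\<close> closed y _ eq i] A by (auto simp: light_sets_def)
  ultimately have "min (y i) (y' i) + int (Suc k) \<le> m" using step[of y] step[of y'] by linarith
  then obtain x where x: "maximizer S W ?w x" "x i + int (Suc k) \<le> m"
    using y y'(1) by (metis min_def)
  then show ?case
    using maximizer_coordinate_mono[OF \<open>finite S\<close> i \<open>0 < s\<close> Suc.prems(3) x(1)] Suc.hyps(2) by simp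
qed

lemma sum_sum_eq_sum_mult_card:
  fixes w :: "'a \<Rightarrow> 'b :: comm_semiring_1"
  assumes "finite S" "G \<subseteq> Pow S"
  shows "(\<Sum>A\<in>G. sum w A) = (\<Sum>j\<in>S. w j * of_nat (card {A \<in> G. j \<in> A}))"
proof -
  have "finite G" using assms by (auto intro: finite_subset)
  have "(\<Sum>A\<in>G. sum w A) = (\<Sum>A\<in>G. \<Sum>j | j \<in> S \<and> j \<in> A. w j)"
    using assms(2) by (intro sum.cong) auto
  also have "\<dots> = (\<Sum>j\<in>S. \<Sum>A | A \<in> G \<and> j \<in> A. w j)"
    using \<open>finite G\<close> \<open>finite S\<close> by (rule sum.swap_restrict)
  finally show ?thesis by (simp add: mult.commute)
qed

lemma transversal_light_sets:
  assumes "S \<noteq> {}" and inj: "inj_on (sum w) (Pow S)"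
  shows "transversal S (Pow S) (light_sets S w)"
proof -
  have "sum w A \<noteq> sum w (S - A)" "S - (S - A) = A" if "A \<subseteq> S" for A
  proof -
    have "A \<noteq> S - A" using \<open>S \<noteq> {}\<close> that by blast
    then show "sum w A \<noteq> sum w (S - A)" using inj that by (auto dest: inj_onD)
    show "S - (S - A) = A" using that by blast
  qed
  then show ?thesis unfolding transversal_def light_sets_def by (auto simp: not_less less_le)
qed

lemma sum_light_sets_le:
  fixes W :: "('a \<Rightarrow> int) set"
  assumes "finite S" and zero: "(\<lambda>_. 0) \<in> W"
    and bound: "\<forall>z\<in>W. \<forall>j\<in>S. z j \<le> m" and closed: "sign_move_closed S W"
    and w: "\<forall>j\<in>S. 0 \<le> w j" and inj: "inj_on (sum w) (Pow S)"
  shows "(\<Sum>A\<in>light_sets S w. sum w A) \<le> m * sum w S"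
proof -
  obtain z where z: "maximizer S W w z" using maximizer_exists[OF _ bound w] zero by blast
  have coordinate: "z j \<le> m - int (card {A \<in> light_sets S w. j \<in> A})" if "j \<in> S" for j
  proof -
    have "inj_on (sum w) {A. A \<subseteq> S \<and> j \<in> A}" by (rule inj_on_subset[OF inj]) auto
    then show ?thesis
      using maximizer_coordinate_le[OF \<open>finite S\<close> bound closed that w _ z] by simp
  qed
  have "0 \<le> weighted_sum S w z" using z zero by (force simp: maximizer_def weighted_sum_def)
  also have "\<dots> \<le> (\<Sum>j\<in>S. w j * (m - int (card {A \<in> light_sets S w. j \<in> A})))"
    unfolding weighted_sum_def using coordinate w by (intro sum_mono mult_left_mono) auto
  also have "\<dots> = m * sum w S - (\<Sum>A\<in>light_sets S w. sum w A)"
    using sum_sum_eq_sum_mult_card[OF \<open>finite S\<close>, of "light_sets S w" w]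
    by (simp add: light_sets_def subset_eq right_diff_distrib sum_subtractf sum_distrib_left
        mult.commute)
  finally show ?thesis by simp
qed

lemma sum_abs_weighted_sum_sign_vec_ge:
  fixes W :: "('a \<Rightarrow> int) set"
  assumes "finite S" "S \<noteq> {}" and zero: "(\<lambda>_. 0) \<in> W"
    and bound: "\<forall>z\<in>W. \<forall>j\<in>S. z j \<le> m" and closed: "sign_move_closed S W"
    and w: "\<forall>j\<in>S. 0 \<le> w j" and inj: "inj_on (sum w) (Pow S)"
  shows "(2 ^ card S - 4 * m) * sum w S \<le> (\<Sum>A\<in>Pow S. \<bar>weighted_sum S w (sign_vec A)\<bar>)"
proof -
  define G where "G = light_sets S w"
  have G: "transversal S (Pow S) G"
    unfolding G_def by (rule transversal_light_sets[OF assms(2) inj])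
  have "2 ^ card S = 2 * int (card G)"
    using card_transversal[OF \<open>finite S\<close> complement_closed_Pow G] card_Pow[OF \<open>finite S\<close>]
    by (metis of_nat_mult of_nat_numeral of_nat_power)
  moreover have "(\<Sum>A\<in>Pow S. \<bar>weighted_sum S w (sign_vec A)\<bar>) =
      2 * (\<Sum>A\<in>G. \<bar>weighted_sum S w (sign_vec A)\<bar>)"
    using \<open>finite S\<close>
    by (intro sum_transversal[OF _ complement_closed_Pow G])
      (auto simp: G_def light_sets_def weighted_sum_sign_vec double_diff)
  moreover have "(\<Sum>A\<in>G. \<bar>weighted_sum S w (sign_vec A)\<bar>) = (\<Sum>A\<in>G. sum w S - 2 * sum w A)"
    using \<open>finite S\<close>
    by (intro sum.cong) (auto simp: G_def light_sets_def weighted_sum_sign_vec sum_diff)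
  moreover have "\<dots> = int (card G) * sum w S - 2 * (\<Sum>A\<in>G. sum w A)"
    by (simp add: sum_subtractf flip: sum_distrib_left)
  moreover have "(\<Sum>A\<in>G. sum w A) \<le> m * sum w S"
    unfolding G_def by (rule sum_light_sets_le[OF assms(1) zero bound closed w inj])
  ultimately show ?thesis by (simp add: left_diff_distrib mult.assoc)
qed

lemma sum_abs_card_imbalance:
  assumes "finite S"
  shows "(\<Sum>A\<in>Pow S. \<bar>2 * int (card A) - int (card S)\<bar>) =
    2 * int (card S) * int (middle_binomial (card S))"
proof -
  let ?g = "\<lambda>A. \<bar>2 * int (card A) - int (card S)\<bar>"
  have "sum ?g (Pow S) = sum ?g (Pow S - halves S)"
    using assms by (intro sum.mono_neutral_right) (auto simp: halves_def)
  also have "\<dots> = 2 * sum ?g (majority S)"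
  proof (rule sum_transversal[OF assms complement_closed_nonhalves transversal_majority])
    fix A assume "A \<in> majority S"
    then have "card (S - A) + card A = card S"
      using card_Diff_subset_add[OF assms] by (simp add: majority_def)
    then show "?g (S - A) = ?g A" by linarith
  qed (fact assms)+
  also have "sum ?g (majority S) = (\<Sum>A\<in>majority S. \<Sum>i\<in>S. sign_vec A i)"
    using assms by (intro sum.cong) (auto simp: majority_def sum_sign_vec)
  also have "\<dots> = (\<Sum>i\<in>S. sign_sum (majority S) i)"
    unfolding sign_sum_def by (rule sum.swap)
  also have "\<dots> = int (card S) * int (middle_binomial (card S))"
    using assms by (simp add: sign_sum_majority)
  finally show ?thesis by simp
qed

lemma distinct_subset_sums_exist:
  assumes "finite S"
  shows "\<exists>e :: 'a \<Rightarrow> int. (\<forall>j. 0 \<le> e j) \<and> inj_on (sum e) (Pow (S :: 'a set))"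
proof -
  obtain f :: "'a \<Rightarrow> nat" where f: "inj_on f S"
    using finite_imp_inj_to_nat_seg[OF assms] by blast
  define e where "e j = (2 :: int) ^ f j" for j
  have encode: "sum e A = int (set_encode (f ` A))" if "A \<subseteq> S" for A
    using inj_on_subset[OF f that] by (simp add: e_def set_encode_def sum.reindex)
  have "inj_on (sum e) (Pow S)"
  proof (rule inj_onI)
    fix A B assume AB: "A \<in> Pow S" "B \<in> Pow S" "sum e A = sum e B"
    then have "finite A" "finite B" using assms finite_subset by auto
    moreover from AB have "set_encode (f ` A) = set_encode (f ` B)" by (simp add: encode)
    ultimately have "f ` A = f ` B" by (simp add: set_encode_eq)
    then show "A = B" using inj_on_image_eq_iff[OF f] AB by auto
  qed
  then show ?thesis by (intro exI[of _ e]) (simp add: e_def)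
qed

lemma inj_on_sum_add_const:
  fixes e :: "'a \<Rightarrow> int"
  assumes "finite S" and e: "\<forall>j. 0 \<le> e j" "inj_on (sum e) (Pow S)" and L: "sum e S < L"
  shows "inj_on (sum (\<lambda>j. L + e j)) (Pow S)"
proof (rule inj_onI)
  have residue: "sum (\<lambda>j. L + e j) A mod L = sum e A" if "A \<in> Pow S" for A
  proof -
    have "sum e A \<le> sum e S" using that \<open>finite S\<close> e(1) by (intro sum_mono2) auto
    then have "0 \<le> sum e A" "sum e A < L" using L e(1) by (simp_all add: sum_nonneg)
    then show ?thesis by (simp add: sum.distrib)
  qed
  fix A B assume "A \<in> Pow S" "B \<in> Pow S" "sum (\<lambda>j. L + e j) A = sum (\<lambda>j. L + e j) B"
  then show "A = B" using residue[of A] residue[of B] e(2) by (simp add: inj_on_def)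
qed

lemma abs_weighted_sum_add_const_le:
  assumes "finite S" "A \<subseteq> S" "0 \<le> L" and e: "\<forall>j\<in>S. 0 \<le> e j"
  shows "\<bar>weighted_sum S (\<lambda>j. L + e j) (sign_vec A)\<bar> \<le>
    L * \<bar>2 * int (card A) - int (card S)\<bar> + sum e S"
proof -
  let ?d = "2 * int (card A) - int (card S)"
  have "weighted_sum S (\<lambda>j. L + e j) (sign_vec A) = L * ?d + weighted_sum S e (sign_vec A)"
    by (simp add: weighted_sum_def distrib_right sum.distrib
        flip: sum_distrib_left sum_sign_vec[OF assms(1,2)])
  moreover have "\<bar>weighted_sum S e (sign_vec A)\<bar> \<le> sum e S"
  proof -
    have "\<bar>weighted_sum S e (sign_vec A)\<bar> \<le> (\<Sum>j\<in>S. \<bar>e j * sign_vec A j\<bar>)"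
      unfolding weighted_sum_def by (rule sum_abs)
    also have "\<dots> = sum e S" using e by (intro sum.cong) (auto simp: sign_vec_def)
    finally show ?thesis .
  qed
  moreover have "\<bar>L * ?d\<bar> = L * \<bar>?d\<bar>" using \<open>0 \<le> L\<close> by (simp add: abs_mult)
  ultimately show ?thesis by linarith
qed

lemma sum_abs_weighted_sum_add_const_le:
  assumes "finite S" "0 \<le> L" and e: "\<forall>j\<in>S. 0 \<le> e j"
  shows "(\<Sum>A\<in>Pow S. \<bar>weighted_sum S (\<lambda>j. L + e j) (sign_vec A)\<bar>) \<le>
    2 * L * int (card S) * int (middle_binomial (card S)) + 2 ^ card S * sum e S"
proof -
  have "(\<Sum>A\<in>Pow S. \<bar>weighted_sum S (\<lambda>j. L + e j) (sign_vec A)\<bar>) \<le>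
      (\<Sum>A\<in>Pow S. L * \<bar>2 * int (card A) - int (card S)\<bar> + sum e S)"
    using abs_weighted_sum_add_const_le[OF \<open>finite S\<close> _ \<open>0 \<le> L\<close> e] by (intro sum_mono) auto
  also have "\<dots> = L * (2 * int (card S) * int (middle_binomial (card S))) + 2 ^ card S * sum e S"
    using \<open>finite S\<close>
    by (simp add: sum.distrib card_Pow sum_abs_card_imbalance flip: sum_distrib_left)
  finally show ?thesis by (simp add: mult_ac)
qed

lemma sign_move_closed_upper_bound_ge:
  fixes W :: "('a \<Rightarrow> int) set"
  assumes "finite S" "S \<noteq> {}" and zero: "(\<lambda>_. 0) \<in> W"
    and bound: "\<forall>z\<in>W. \<forall>j\<in>S. z j \<le> m" and "sign_move_closed S W"
  shows "2 ^ (card S - 1) - int (middle_binomial (card S)) \<le> 2 * m"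
proof (rule ccontr)
  define n and C where "n = card S" and "C = int (middle_binomial (card S))"
  assume "\<not> 2 ^ (card S - 1) - int (middle_binomial (card S)) \<le> 2 * m"
  moreover have "n > 0" using assms by (simp add: n_def card_gt_0_iff)
  then have "2 ^ n = 2 * (2 :: int) ^ (n - 1)" by (simp flip: power_Suc)
  ultimately have excess: "1 \<le> 2 ^ n - 4 * m - 2 * C" by (simp add: n_def C_def)
  obtain e :: "'a \<Rightarrow> int" where e: "\<forall>j. 0 \<le> e j" "inj_on (sum e) (Pow S)"
    using distinct_subset_sums_exist[OF \<open>finite S\<close>] by blast
  define E where "E = sum e S"
  define L where "L = 4 * m * E + E + 1"
  have "0 \<le> m" using bound zero \<open>S \<noteq> {}\<close> by fastforce
  moreover have "0 \<le> E" using e(1) by (simp add: E_def sum_nonneg)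
  ultimately have "0 \<le> 4 * m * E" by simp
  then have L: "E < L" "4 * m * E < L" "0 \<le> L" using \<open>0 \<le> E\<close> by (simp_all add: L_def)
  let ?w = "\<lambda>j. L + e j"
  have "inj_on (sum ?w) (Pow S)"
    using inj_on_sum_add_const[OF \<open>finite S\<close> e] L(1) by (simp add: E_def)
  moreover have "\<forall>j\<in>S. 0 \<le> ?w j" using L(3) e(1) by simp
  ultimately have "(2 ^ n - 4 * m) * sum ?w S \<le> (\<Sum>A\<in>Pow S. \<bar>weighted_sum S ?w (sign_vec A)\<bar>)"
    unfolding n_def by (intro sum_abs_weighted_sum_sign_vec_ge[OF assms])
  also have "\<dots> \<le> 2 * L * int n * C + 2 ^ n * E"
    unfolding n_def C_def E_def
    using e(1) by (intro sum_abs_weighted_sum_add_const_le[OF \<open>finite S\<close> L(3)]) simp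
  also have "sum ?w S = L * int n + E" by (simp add: sum.distrib n_def E_def mult.commute)
  finally have "L * int n * (2 ^ n - 4 * m - 2 * C) \<le> 4 * m * E" by (simp add: algebra_simps)
  moreover have "L * 1 * 1 \<le> L * int n * (2 ^ n - 4 * m - 2 * C)"
    using L(3) \<open>n > 0\<close> excess by (intro mult_mono) auto
  ultimately show False using L(2) by simp
qed

section \<open>Reachable positions\<close>

definition reachable :: "nat \<Rightarrow> ((nat \<Rightarrow> real) list \<Rightarrow> (nat \<Rightarrow> real) \<Rightarrow> real) \<Rightarrow> (nat \<Rightarrow> int) set" where
  "reachable n \<sigma> = {z. \<exists>vs k. (\<forall>k. vs k \<in> Vset n) \<and>
    (\<forall>i<n. game_pos \<sigma> vs k i = real_of_int (z i))}"

definition offer :: "nat \<Rightarrow> nat set \<Rightarrow> nat \<Rightarrow> real" where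
  "offer n A i = (if i < n then real_of_int (sign_vec A i) else 0)"

lemma offer_in_Vset: "n > 0 \<Longrightarrow> 0 \<in> A \<Longrightarrow> offer n A \<in> Vset n"
  by (auto simp: Vset_def offer_def sign_vec_def)

lemma zero_in_reachable:
  assumes "n > 0"
  shows "(\<lambda>_. 0) \<in> reachable n \<sigma>"
  unfolding reachable_def using offer_in_Vset[OF assms, of "{0}"]
  by (auto intro!: exI[of _ "\<lambda>_. offer n {0}"] exI[of _ 0])

lemma game_pos_cong: "(\<And>j. j < k \<Longrightarrow> vs j = vs' j) \<Longrightarrow> game_pos \<sigma> vs k = game_pos \<sigma> vs' k"
proof (induction k)
  case (Suc k)
  have "map vs [0..<k] = map vs' [0..<k]" using Suc.prems by simp
  moreover have "game_pos \<sigma> vs k = game_pos \<sigma> vs' k" "vs k = vs' k" using Suc by auto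
  ultimately show ?case by (simp only: game_pos.simps)
qed simp

lemma game_pos_fun_upd:
  "game_pos \<sigma> (vs(k := v)) (Suc k) = (\<lambda>i. game_pos \<sigma> vs k i + \<sigma> (map vs [0..<k]) v * v i)"
proof -
  have "game_pos \<sigma> (vs(k := v)) k = game_pos \<sigma> vs k" by (rule game_pos_cong) simp
  then show ?thesis by simp
qed

lemma reachable_move:
  assumes "n > 0" and sign: "\<And>h v. \<sigma> h v \<in> {- 1, 1}" and z: "z \<in> reachable n \<sigma>" and "0 \<in> A"
  shows "\<exists>e\<in>{- 1, 1}. (\<lambda>i. z i + e * sign_vec A i) \<in> reachable n \<sigma>"
proof -
  obtain vs k where vs: "\<And>k. vs k \<in> Vset n"
    and pos: "\<And>i. i < n \<Longrightarrow> game_pos \<sigma> vs k i = real_of_int (z i)"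
    using z unfolding reachable_def by blast
  obtain e :: int where e: "e \<in> {- 1, 1}" "\<sigma> (map vs [0..<k]) (offer n A) = real_of_int e"
    using sign[of "map vs [0..<k]" "offer n A"] by force
  let ?vs = "vs(k := offer n A)"
  have "game_pos \<sigma> ?vs (Suc k) i = real_of_int (z i + e * sign_vec A i)" if "i < n" for i
    unfolding game_pos_fun_upd e(2) using pos that by (simp add: offer_def)
  moreover have "?vs l \<in> Vset n" for l using vs offer_in_Vset[OF \<open>n > 0\<close> \<open>0 \<in> A\<close>] by simp
  ultimately have "(\<lambda>i. z i + e * sign_vec A i) \<in> reachable n \<sigma>"
    unfolding reachable_def by blast
  then show ?thesis using e(1) by blast
qed

lemma sign_move_closed_reachable:
  assumes "n > 0" and "\<And>h v. \<sigma> h v \<in> {- 1, 1}"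
  shows "sign_move_closed {..<n} (reachable n \<sigma>)"
  unfolding sign_move_closed_def
proof (intro ballI allI impI)
  fix z A assume z: "z \<in> reachable n \<sigma>"
  show "\<exists>z'\<in>reachable n \<sigma>. \<exists>e\<in>{- 1, 1}. \<forall>j\<in>{..<n}. z' j = z j + e * sign_vec A j"
  proof (cases "0 \<in> A")
    case True
    then obtain e where "e \<in> {- 1, 1}" "(\<lambda>i. z i + e * sign_vec A i) \<in> reachable n \<sigma>"
      using reachable_move[OF assms z] by metis
    then show ?thesis by (intro bexI[of _ "\<lambda>i. z i + e * sign_vec A i"] bexI[of _ e]) simp_all
  next
    case False
    then have "0 \<in> {..<n} - A" using \<open>n > 0\<close> by simp
    then obtain e where e: "e \<in> {- 1, 1}"
      "(\<lambda>i. z i + e * sign_vec ({..<n} - A) i) \<in> reachable n \<sigma>"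
      using reachable_move[OF assms z] by metis
    have "\<forall>j\<in>{..<n}. z j + e * sign_vec ({..<n} - A) j = z j + (- e) * sign_vec A j"
      by (simp add: sign_vec_Diff)
    moreover have "- e \<in> {- 1, 1}" using e(1) by auto
    ultimately show ?thesis using e(2)
      by (intro bexI[of _ "\<lambda>i. z i + e * sign_vec ({..<n} - A) i"] bexI[of _ "- e"])
  qed
qed

lemma chooser_wins_imp_le_floor:
  assumes "n > 0" "chooser_wins (Vset n) (Kset n M)"
  shows "2 ^ (n - 1) - int (middle_binomial n) \<le> 2 * \<lfloor>M\<rfloor>"
proof -
  obtain \<sigma> where sign: "\<And>h v. \<sigma> h v \<in> {- 1, 1}"
    and keep: "\<And>vs k. (\<And>k. vs k \<in> Vset n) \<Longrightarrow> game_pos \<sigma> vs k \<in> Kset n M"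
    using assms(2) unfolding chooser_wins_def by blast
  have "\<forall>z\<in>reachable n \<sigma>. \<forall>j\<in>{..<n}. z j \<le> \<lfloor>M\<rfloor>"
  proof (intro ballI)
    fix z j assume "z \<in> reachable n \<sigma>" "j \<in> {..<n}"
    then obtain vs k where "\<And>k. vs k \<in> Vset n" "game_pos \<sigma> vs k j = real_of_int (z j)"
      unfolding reachable_def by blast
    then have "real_of_int (z j) \<le> M" using keep[of vs k] \<open>j \<in> {..<n}\<close> by (auto simp: Kset_def)
    then show "z j \<le> \<lfloor>M\<rfloor>" by (simp add: le_floor_iff)
  qed
  then show ?thesis
    using sign_move_closed_upper_bound_ge[of "{..<n}" "reachable n \<sigma>" "\<lfloor>M\<rfloor>"]
      zero_in_reachable[OF \<open>n > 0\<close>] sign_move_closed_reachable[OF \<open>n > 0\<close>, of \<sigma>] sign \<open>n > 0\<close>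
    by auto
qed

section \<open>The critical value\<close>

lemma crit_eq_middle_binomial:
  assumes "n > 1"
  shows "crit n = 2 ^ (n - 2) - real (middle_binomial n div 2)"
proof -
  have "real (middle_binomial n) =
      2 * real (middle_binomial n div 2) + real (middle_binomial n mod 2)"
    by (metis mult_div_mod_eq of_nat_add of_nat_mult of_nat_numeral)
  then have half: "real (middle_binomial n div 2) =
      real (middle_binomial n) / 2 - (if \<exists>k. n = 2 ^ k then 1 / 2 else 0)"
    using odd_middle_binomial_iff_power_of_2[of n] assms by (auto simp: mod2_eq_if field_simps)
  show ?thesis
  proof (cases "even n")
    case True
    then show ?thesis unfolding half by (simp add: crit_def middle_binomial_def)
  next
    case False
    then have "(n - 1) div 2 = n div 2" "\<nexists>k. n = 2 ^ k"
      using odd_eq_power_of_2_iff[OF False] assms by (auto elim: oddE)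
    then show ?thesis unfolding half using False by (simp add: crit_def middle_binomial_def)
  qed
qed

lemma power_minus_crit_bigo: "(\<lambda>m. 2 ^ (m - 2) - crit m) \<in> O(\<lambda>m. 2 ^ (m - 2) / sqrt (real m))"
proof (rule bigoI[where c = 1])
  have "norm (2 ^ (m - 2) - crit m) \<le> 1 * norm (2 ^ (m - 2) / sqrt (real m))" if "m \<ge> 2" for m
  proof -
    have "norm (2 ^ (m - 2) - crit m) \<le> real (middle_binomial m) / 2"
      using crit_eq_middle_binomial[of m] that by simp
    also note middle_binomial_le_power_div_sqrt[OF that]
    finally show ?thesis by simp
  qed
  then show "\<forall>\<^sub>F m in at_top. norm (2 ^ (m - 2) - crit m) \<le> 1 * norm (2 ^ (m - 2) / sqrt (real m))"
    unfolding eventually_at_top_linorder by blast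
qed

lemma chooser_wins_imp_crit_le:
  assumes "n > 1" and win: "chooser_wins (Vset n) (Kset n M)"
  shows "crit n \<le> M"
proof -
  have "(2 :: int) ^ (n - 1) = 2 * 2 ^ (n - 2)"
    using \<open>n > 1\<close> by (simp add: numeral_2_eq_2 Suc_diff_Suc flip: power_Suc)
  then have "2 ^ (n - 2) - int (middle_binomial n div 2) \<le> \<lfloor>M\<rfloor>"
    using chooser_wins_imp_le_floor[OF _ win] \<open>n > 1\<close> by linarith
  then show ?thesis using \<open>n > 1\<close> by (simp add: crit_eq_middle_binomial le_floor_iff)
qed

lemma crit_le_imp_chooser_wins:
  assumes "n > 1" and M: "crit n \<le> M"
  shows "chooser_wins (Vset n) (Kset n M)"
proof -
  obtain F where F: "transversal {..<n} (Pow {..<n}) F"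
    and balanced: "\<And>i. i < n \<Longrightarrow> 2 * int (middle_binomial n div 2) \<le> sign_sum F i"
    using balanced_transversal_Pow[of "{..<n}"] \<open>n > 1\<close> by auto
  have power: "(2 :: real) ^ (n - 1) = 2 * 2 ^ (n - 2)"
    using \<open>n > 1\<close> by (simp add: numeral_2_eq_2 Suc_diff_Suc flip: power_Suc)
  show ?thesis
  proof (rule chooser_wins_of_transversal[OF _ F])
    fix i assume "i < n"
    then have "real_of_int (2 * int (middle_binomial n div 2)) \<le> real_of_int (sign_sum F i)"
      using balanced by (simp only: of_int_le_iff)
    then show "2 ^ (n - 1) - real_of_int (sign_sum F i) \<le> 2 * M"
      unfolding power using M \<open>n > 1\<close> by (simp add: crit_eq_middle_binomial)
  qed (use \<open>n > 1\<close> in simp)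
qed

theorem theorem1p4:
  fixes n :: nat and M :: real
  assumes "n > 1"
  shows "(odd n \<longrightarrow>
            (chooser_wins (Vset n) (Kset n M) \<longleftrightarrow>
             M \<ge> 2 ^ (n - 2) - (n - 1 choose ((n - 1) div 2)) / 2))
       \<and> (even n \<and> \<not> (\<exists>k. n = 2 ^ k) \<longrightarrow>
            (chooser_wins (Vset n) (Kset n M) \<longleftrightarrow>
             M \<ge> 2 ^ (n - 2) - (n - 1 choose (n div 2)) / 2))
       \<and> ((\<exists>k. n = 2 ^ k) \<longrightarrow>
            (chooser_wins (Vset n) (Kset n M) \<longleftrightarrow>
             M \<ge> 2 ^ (n - 2) - (n - 1 choose (n div 2)) / 2 + 1 / 2))
       \<and> (\<lambda>m. 2 ^ (m - 2) - crit m) \<in> O(\<lambda>m. 2 ^ (m - 2) / sqrt (real m))"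
proof -
  have "chooser_wins (Vset n) (Kset n M) \<longleftrightarrow> crit n \<le> M"
    using chooser_wins_imp_crit_le crit_le_imp_chooser_wins assms by blast
  moreover have "even n" if "\<exists>k. n = 2 ^ k"
    using odd_eq_power_of_2_iff[of n] that assms by auto
  ultimately show ?thesis using power_minus_crit_bigo by (auto simp: crit_def)
qed

end
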